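(* There exists a positive integer $n_0$ such that $\mathrm{Vol}(U_n)<\mathrm{Vol}(0.891\,\mathbb{B}^n)$ for all $n\ge n_0$.
   Context: $\mathbb{E}^n$ denotes $n$-dimensional Euclidean space with Euclidean norm $|\cdot|$, $\mathbb{E}^n_+$ is the subset of $\mathbb{E}^n$ consisting of the points all of whose coordinates are non-negative, and $\mathbb{B}^n$ is the unit ball in $\mathbb{E}^n$ (so $0.891\,\mathbb{B}^n$ is the ball of radius $0.891$). For a positive integer $m$ define $$M_m:=\bigl\{v-w \mid v,w\in\mathbb{E}^m_+,\ |v|^2+\bigl(|w|+\sqrt{2}\bigr)^2\le 4\bigr\}\subset\mathbb{E}^m.$$ $U_n$ is the orthogonal projection of $M_{n+1}$ onto the $n$-dimensional subspace $(1,\ldots,1)^\perp$ of $\mathbb{E}^{n+1}$ orthogonal to $(1,\dots,1)\in\mathbb{E}^{n+1}$: $$U_n=\{\operatorname{proj}_{(1,\ldots,1)^\perp}(v)\mid v\in M_{n+1}\}.$$ This subspace is identified isometrically with $\mathbb{E}^n$, and $\mathrm{Vol}$ denotes $n$-dimensional volume (Lebesgue measure). *)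

theory Defs
  imports "HOL-Analysis.Analysis"
begin

section \<open>Euclidean spaces of variable dimension\<close>

text \<open>
  The dimension is quantified inside the theorem, so it cannot be a type. Euclidean \<open>n\<close>-space is
  the space underlying the product measure \<open>Pi\<^sub>M {..<n} (\<lambda>_. lborel)\<close>: functions on
  \<open>{..<n}\<close> that are extended by \<open>undefined\<close> outside \<open>{..<n}\<close>.
\<close>

type_synonym vect = "nat \<Rightarrow> real"

definition E_space :: "nat \<Rightarrow> vect set" where
  "E_space n = {..<n} \<rightarrow>\<^sub>E UNIV"

definition E_nonneg :: "nat \<Rightarrow> vect set" where
  "E_nonneg n = {x \<in> E_space n. \<forall>i<n. 0 \<le> x i}"

definition E_diff :: "nat \<Rightarrow> vect \<Rightarrow> vect \<Rightarrow> vect" where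
  "E_diff n x y = (\<lambda>i\<in>{..<n}. x i - y i)"

definition E_inner :: "nat \<Rightarrow> vect \<Rightarrow> vect \<Rightarrow> real" where
  "E_inner n x y = (\<Sum>i<n. x i * y i)"

definition E_norm :: "nat \<Rightarrow> vect \<Rightarrow> real" where
  "E_norm n x = L2_set x {..<n}"

definition E_ball :: "nat \<Rightarrow> real \<Rightarrow> vect set" where
  "E_ball n r = {x \<in> E_space n. E_norm n x \<le> r}"

definition Vol :: "nat \<Rightarrow> vect set \<Rightarrow> ennreal" where
  "Vol n S = emeasure (Pi\<^sub>M {..<n} (\<lambda>_. lborel)) S"

definition is_orth_proj :: "nat \<Rightarrow> vect set \<Rightarrow> vect \<Rightarrow> vect \<Rightarrow> bool" where
  "is_orth_proj m S v p \<longleftrightarrow> p \<in> S \<and> (\<forall>s\<in>S. E_inner m (E_diff m v p) s = 0)"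

definition orth_proj :: "nat \<Rightarrow> vect set \<Rightarrow> vect \<Rightarrow> vect" where
  "orth_proj m S v = (THE p. is_orth_proj m S v p)"


section \<open>The bodies \<open>M\<^sub>m\<close> and \<open>U\<^sub>n\<close>\<close>

definition M_body :: "nat \<Rightarrow> vect set" where
  "M_body m = {E_diff m v w | v w. v \<in> E_nonneg m \<and> w \<in> E_nonneg m \<and>
     (E_norm m v)\<^sup>2 + (E_norm m w + sqrt 2)\<^sup>2 \<le> 4}"

definition ones_perp :: "nat \<Rightarrow> vect set" where
  "ones_perp m = {x \<in> E_space m. E_inner m x (\<lambda>i\<in>{..<m}. 1) = 0}"

definition U_body :: "nat \<Rightarrow> vect set" where
  "U_body n = orth_proj (Suc n) (ones_perp (Suc n)) ` M_body (Suc n)"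

text \<open>
  An isometric identification of \<open>\<bbbE>\<^sup>n\<close> with the hyperplane orthogonal to \<open>(1,\<dots>,1)\<close> in
  \<open>\<bbbE>\<^sup>n\<^sup>+\<^sup>1\<close>. The volume of a subset of the hyperplane is the volume of its preimage in
  \<open>\<bbbE>\<^sup>n\<close>.
\<close>

definition hyperplane_ident :: "nat \<Rightarrow> (vect \<Rightarrow> vect) \<Rightarrow> bool" where
  "hyperplane_ident n \<phi> \<longleftrightarrow>
     \<phi> ` E_space n = ones_perp (Suc n) \<and>
     (\<forall>x\<in>E_space n. \<forall>y\<in>E_space n.
        E_norm (Suc n) (E_diff (Suc n) (\<phi> x) (\<phi> y)) = E_norm n (E_diff n x y))"

definition pullback :: "nat \<Rightarrow> (vect \<Rightarrow> vect) \<Rightarrow> vect set \<Rightarrow> vect set" where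
  "pullback n \<phi> S = {x \<in> E_space n. \<phi> x \<in> S}"


section \<open>Well-definedness\<close>

lemma is_orth_proj_ones_perp:
  assumes "m > 0"
  shows "is_orth_proj m (ones_perp m) v p \<longleftrightarrow>
           p = (\<lambda>i\<in>{..<m}. v i - (\<Sum>j<m. v j) / real m)" (is "_ \<longleftrightarrow> p = ?q")
proof
  have q: "?q \<in> ones_perp m"
    using assms by (simp add: ones_perp_def E_space_def E_inner_def sum_subtractf)
  show "is_orth_proj m (ones_perp m) v p" if "p = ?q"
    unfolding that is_orth_proj_def
  proof (intro conjI ballI q)
    fix s assume "s \<in> ones_perp m"
    then have "(\<Sum>i<m. s i) = 0" by (simp add: ones_perp_def E_inner_def)
    moreover have "E_inner m (E_diff m v ?q) s = (\<Sum>i<m. (\<Sum>j<m. v j) / real m * s i)"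
      unfolding E_inner_def by (intro sum.cong) (auto simp: E_diff_def)
    ultimately show "E_inner m (E_diff m v ?q) s = 0"
      by (simp only: sum_distrib_left [symmetric])
  qed
  assume p: "is_orth_proj m (ones_perp m) v p"
  define d where "d = (\<lambda>i\<in>{..<m}. ?q i - p i)"
  have pm: "p \<in> ones_perp m" using p by (simp add: is_orth_proj_def)
  have sum0: "(\<Sum>i<m. x i) = 0" if "x \<in> ones_perp m" for x
    using that by (simp add: ones_perp_def E_inner_def)
  have "(\<Sum>i<m. d i) = (\<Sum>i<m. ?q i) - (\<Sum>i<m. p i)"
    unfolding sum_subtractf [symmetric] by (intro sum.cong) (simp_all add: d_def)
  then have s: "(\<Sum>i<m. d i) = 0"
    by (simp only: sum0 [OF q] sum0 [OF pm])
  then have "d \<in> ones_perp m"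
    by (simp add: ones_perp_def E_inner_def E_space_def) (simp add: d_def)
  then have 0: "E_inner m (E_diff m v p) d = 0"
    using p by (simp only: is_orth_proj_def)
  define c where "c = (\<Sum>j<m. v j) / real m"
  have "E_inner m (E_diff m v p) d = (\<Sum>i<m. d i * d i + c * d i)"
    unfolding E_inner_def
    by (intro sum.cong) (simp_all add: E_diff_def d_def c_def [symmetric] algebra_simps)
  also have "\<dots> = (\<Sum>i<m. d i * d i) + c * (\<Sum>i<m. d i)"
    by (simp only: sum.distrib sum_distrib_left)
  finally have "(\<Sum>i<m. d i * d i) = 0" using 0 s by simp
  then have "\<forall>i<m. d i = 0" by (simp add: sum_nonneg_eq_0_iff)
  then have "\<forall>i<m. p i = ?q i" by (auto simp: d_def)
  moreover have "p \<in> extensional {..<m}"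
    using pm by (auto simp: ones_perp_def E_space_def PiE_def)
  ultimately show "p = ?q"
    by (intro extensionalityI [where A = "{..<m}"]) auto
qed

lemma orth_proj_ones_perp:
  "m > 0 \<Longrightarrow> orth_proj m (ones_perp m) v = (\<lambda>i\<in>{..<m}. v i - (\<Sum>j<m. v j) / real m)"
  by (simp add: orth_proj_def is_orth_proj_ones_perp)

lemma ex_hyperplane_ident:
  assumes "n > 0"
  shows "\<exists>\<phi>. hyperplane_ident n \<phi>"
proof -
  define c where "c = 1 / sqrt (real (Suc n))"
  define a where "a = c\<^sup>2 / (1 - c)"
  have c: "0 < c" "c < 1" using assms by (auto simp: c_def)
  have c2: "c\<^sup>2 * (real n + 1) = 1" by (simp add: c_def power_divide)
  have a: "a * (1 - c) = c\<^sup>2" using c by (simp add: a_def)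
  have "(real n * a) * (1 - c) = real n * c\<^sup>2" by (simp only: mult.assoc a)
  also have "\<dots> = 1 - c\<^sup>2" using c2 by (simp add: algebra_simps)
  also have "\<dots> = (1 + c) * (1 - c)" by (simp add: power2_eq_square algebra_simps)
  finally have na: "real n * a = 1 + c" using c by simp
  \<comment> \<open>the reflection that exchanges the last unit vector and \<open>(c,\<dots>,c)\<close>\<close>
  define \<phi> where "\<phi> x = (\<lambda>i\<in>{..<Suc n}. if i < n then x i - a * (\<Sum>j<n. x j) else c * (\<Sum>j<n. x j))"
    for x :: vect
  have mem: "\<phi> x \<in> ones_perp (Suc n)" for x
  proof -
    have "(\<Sum>i<Suc n. \<phi> x i) = (\<Sum>i<n. x i) * (1 + c - real n * a)"
      by (simp add: \<phi>_def sum_subtractf algebra_simps)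
    then show ?thesis
      by (simp add: na ones_perp_def E_space_def E_inner_def del: sum.lessThan_Suc)
         (simp add: \<phi>_def)
  qed
  have surj: "y \<in> \<phi> ` E_space n" if y: "y \<in> ones_perp (Suc n)" for y
  proof
    define s where "s = y n / c"
    define x where "x = (\<lambda>i\<in>{..<n}. y i + a * s)"
    have "(\<Sum>i<n. y i) + y n = 0" using y by (simp add: ones_perp_def E_inner_def)
    then have "(\<Sum>i<n. x i) = - (c * s) + (real n * a) * s"
      using c by (simp add: x_def sum.distrib s_def)
    then have s: "(\<Sum>i<n. x i) = s" unfolding na by (simp add: algebra_simps)
    show "x \<in> E_space n" by (simp add: x_def E_space_def)
    have "y \<in> extensional {..<Suc n}" using y by (auto simp: ones_perp_def E_space_def PiE_def)
    then show "y = \<phi> x"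
    proof (rule extensionalityI)
      show "\<phi> x \<in> extensional {..<Suc n}" by (simp add: \<phi>_def)
      fix i assume "i \<in> {..<Suc n}"
      then consider "i < n" | "i = n" by fastforce
      then show "y i = \<phi> x i"
        by cases (use c in \<open>simp_all add: \<phi>_def s\<close>, simp_all add: x_def s_def)
    qed
  qed
  have iso: "E_norm (Suc n) (E_diff (Suc n) (\<phi> x) (\<phi> y)) = E_norm n (E_diff n x y)" for x y
  proof -
    define d where "d = (\<lambda>i. x i - y i)"
    define s where "s = (\<Sum>i<n. d i)"
    have "(\<Sum>i<Suc n. (E_diff (Suc n) (\<phi> x) (\<phi> y) i)\<^sup>2) = (\<Sum>i<n. (d i - a * s)\<^sup>2) + (c * s)\<^sup>2"
      by (simp add: E_diff_def \<phi>_def d_def s_def sum_subtractf algebra_simps)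
    also have "(\<Sum>i<n. (d i - a * s)\<^sup>2) = (\<Sum>i<n. (d i)\<^sup>2 - 2 * a * s * d i + a\<^sup>2 * s\<^sup>2)"
      by (intro sum.cong) (auto simp: power2_eq_square algebra_simps)
    also have "\<dots> = (\<Sum>i<n. (d i)\<^sup>2) - 2 * a * s * s + real n * a * a * s\<^sup>2"
      by (simp add: sum.distrib sum_subtractf sum_distrib_left [symmetric] s_def power2_eq_square)
    also have "\<dots> + (c * s)\<^sup>2 = (\<Sum>i<n. (d i)\<^sup>2) + s\<^sup>2 * (c\<^sup>2 - a * (1 - c))"
      unfolding na by (simp add: power2_eq_square algebra_simps)
    finally show ?thesis
      by (simp add: a E_norm_def L2_set_def d_def E_diff_def)
  qed
  have "hyperplane_ident n \<phi>"
    unfolding hyperplane_ident_def using mem surj iso by blast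
  then show ?thesis by blast
qed


text \<open>
  The sets whose volume is taken are measurable, so \<open>emeasure\<close> does not return its default
  value \<open>0\<close> on them.
\<close>

lemma continuous_coord:
  fixes f :: "'a::topological_space \<Rightarrow> vect"
  shows "continuous_on S f \<Longrightarrow> continuous_on S (\<lambda>x. f x i)"
  by (rule continuous_on_product_then_coordinatewise)

lemma continuous_restrict_fun:
  fixes f :: "'a::topological_space \<Rightarrow> vect"
  assumes "\<And>i. i < m \<Longrightarrow> continuous_on S (\<lambda>x. f x i)"
  shows "continuous_on S (\<lambda>x. \<lambda>i\<in>{..<m}. f x i)"
proof (rule continuous_on_coordinatewise_then_product)
  fix i show "continuous_on S (\<lambda>x. restrict (f x) {..<m} i)"
    using assms [of i] by (cases "i < m") (auto simp: restrict_def)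
qed

lemma compact_box: "compact ({..<m} \<rightarrow>\<^sub>E {a..b} :: vect set)"
proof -
  have "({..<m} \<rightarrow>\<^sub>E {a..b} :: vect set)
      = (\<Pi>\<^sub>E i\<in>UNIV. if i < m then {a..b} else {undefined})"
    by (auto simp: PiE_def Pi_def extensional_def split: if_splits)
  moreover have "compactin (product_topology (\<lambda>_. euclidean) UNIV)
      (\<Pi>\<^sub>E i\<in>UNIV. if i < m then {a..b} else {undefined} :: real set)"
    by (subst compactin_PiE) auto
  ultimately show ?thesis
    by (simp add: euclidean_product_topology)
qed

lemma coord_le_E_norm: "i < n \<Longrightarrow> \<bar>x i\<bar> \<le> E_norm n x"
  unfolding E_norm_def using member_le_L2_set [of "{..<n}" i "\<lambda>i. \<bar>x i\<bar>"]
  by (simp add: L2_set_def)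

lemma continuous_E_norm [continuous_intros]:
  fixes f :: "'a::topological_space \<Rightarrow> vect"
  shows "continuous_on S f \<Longrightarrow> continuous_on S (\<lambda>x. E_norm n (f x))"
  unfolding E_norm_def L2_set_def
  by (intro continuous_on_real_sqrt continuous_on_sum continuous_on_power continuous_coord)

lemma compact_M_body: "compact (M_body m)"
proof -
  let ?B = "{..<m} \<rightarrow>\<^sub>E {0..2} :: vect set"
  define P where "P = {z \<in> ?B \<times> ?B. (E_norm m (fst z))\<^sup>2 + (E_norm m (snd z) + sqrt 2)\<^sup>2 \<le> 4}"
  have "closed {z :: vect \<times> vect. (E_norm m (fst z))\<^sup>2 + (E_norm m (snd z) + sqrt 2)\<^sup>2 \<le> 4}"
    by (intro closed_Collect_le continuous_intros)
  then have "compact ((?B \<times> ?B) \<inter> {z. (E_norm m (fst z))\<^sup>2 + (E_norm m (snd z) + sqrt 2)\<^sup>2 \<le> 4})"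
    by (intro compact_Int_closed compact_Times compact_box)
  moreover have "P = (?B \<times> ?B) \<inter> {z. (E_norm m (fst z))\<^sup>2 + (E_norm m (snd z) + sqrt 2)\<^sup>2 \<le> 4}"
    unfolding P_def by blast
  ultimately have "compact P" by simp
  moreover have "continuous_on P (\<lambda>z. E_diff m (fst z) (snd z))"
    unfolding E_diff_def
    by (intro continuous_restrict_fun [where f = "\<lambda>z i. fst z i - snd z i"] continuous_on_diff
        continuous_coord continuous_on_fst continuous_on_snd continuous_on_id)
  moreover have "M_body m = (\<lambda>z. E_diff m (fst z) (snd z)) ` P"
  proof -
    have box: "v \<in> ?B \<and> w \<in> ?B"
      if "v \<in> E_nonneg m" "w \<in> E_nonneg m" and le: "(E_norm m v)\<^sup>2 + (E_norm m w + sqrt 2)\<^sup>2 \<le> 4" for v w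
    proof -
      have sq: "a \<le> 2" if "a\<^sup>2 + b\<^sup>2 \<le> 4" for a b :: real
      proof -
        have "a\<^sup>2 \<le> 4" using that zero_le_power2 [of b] by linarith
        then show ?thesis using power2_le_imp_le [of a 2] by simp
      qed
      have "E_norm m v \<le> 2" "E_norm m w + sqrt 2 \<le> 2"
        using le sq [of "E_norm m v" "E_norm m w + sqrt 2"]
          sq [of "E_norm m w + sqrt 2" "E_norm m v"] by (simp_all only: add.commute)
      moreover have "0 \<le> sqrt (2::real)" by simp
      ultimately have "\<bar>v i\<bar> \<le> 2 \<and> \<bar>w i\<bar> \<le> 2" if "i < m" for i
        using coord_le_E_norm [OF that, of v] coord_le_E_norm [OF that, of w] by linarith
      then have "\<forall>i<m. v i \<le> 2 \<and> w i \<le> 2"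
        using abs_le_D1 by blast
      then show ?thesis using that by (auto simp: E_nonneg_def E_space_def PiE_iff)
    qed
    have sub: "v \<in> E_nonneg m" if "v \<in> ?B" for v
      using that by (auto simp: E_nonneg_def E_space_def PiE_iff)
    show ?thesis
    proof (intro equalityI subsetI)
      fix x assume "x \<in> M_body m"
      then obtain v w where x: "x = E_diff m v w" and "v \<in> E_nonneg m" "w \<in> E_nonneg m"
        and "(E_norm m v)\<^sup>2 + (E_norm m w + sqrt 2)\<^sup>2 \<le> 4"
        unfolding M_body_def by blast
      then have "(v, w) \<in> P" using box unfolding P_def by simp
      then show "x \<in> (\<lambda>z. E_diff m (fst z) (snd z)) ` P" using x by force
    next
      fix x assume "x \<in> (\<lambda>z. E_diff m (fst z) (snd z)) ` P"
      then obtain z where "x = E_diff m (fst z) (snd z)" "fst z \<in> ?B" "snd z \<in> ?B"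
        "(E_norm m (fst z))\<^sup>2 + (E_norm m (snd z) + sqrt 2)\<^sup>2 \<le> 4"
        unfolding P_def by (auto simp: mem_Times_iff)
      then show "x \<in> M_body m" unfolding M_body_def using sub by blast
    qed
  qed
  ultimately show ?thesis by (simp add: compact_continuous_image)
qed

lemma compact_U_body: "compact (U_body n)"
proof -
  have "orth_proj (Suc n) (ones_perp (Suc n))
      = (\<lambda>v. \<lambda>i\<in>{..<Suc n}. v i - (\<Sum>j<Suc n. v j) / real (Suc n))"
    by (rule ext) (rule orth_proj_ones_perp, simp)
  moreover have "continuous_on (M_body (Suc n))
      (\<lambda>v. \<lambda>i\<in>{..<Suc n}. v i - (\<Sum>j<Suc n. v j) / real (Suc n))"
    by (intro continuous_restrict_fun [where f = "\<lambda>v i. v i - (\<Sum>j<Suc n. v j) / real (Suc n)"]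
        continuous_on_diff continuous_on_divide continuous_on_sum continuous_on_const
        continuous_coord continuous_on_id) auto
  ultimately show ?thesis
    unfolding U_body_def by (metis compact_continuous_image compact_M_body)
qed

lemma sets_E_space:
  assumes "closed K" "K \<subseteq> E_space n"
  shows "K \<in> sets (Pi\<^sub>M {..<n} (\<lambda>_. lborel))"
proof -
  have "(\<lambda>x. x) \<in> measurable (Pi\<^sub>M {..<n} (\<lambda>_. lborel :: real measure)) (Pi\<^sub>M UNIV (\<lambda>_. borel))"
  proof (rule measurable_PiM_single')
    fix i :: nat
    show "(\<lambda>x. x i) \<in> borel_measurable (Pi\<^sub>M {..<n} (\<lambda>_. lborel :: real measure))"
    proof (cases "i < n")
      case True
      then have "(\<lambda>x. x i) \<in> measurable (Pi\<^sub>M {..<n} (\<lambda>_. lborel :: real measure)) lborel"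
        by (intro measurable_component_singleton) auto
      then show ?thesis by simp
    next
      case False
      then have "\<And>x. x \<in> space (Pi\<^sub>M {..<n} (\<lambda>_. lborel :: real measure)) \<Longrightarrow> x i = undefined"
        by (auto simp: space_PiM PiE_def extensional_def)
      then show ?thesis by (subst measurable_cong [where g = "\<lambda>_. undefined"]) auto
    qed
  qed (auto simp: space_PiM)
  moreover have "K \<in> sets (Pi\<^sub>M UNIV (\<lambda>_. borel))"
    using assms(1) by (simp add: sets_PiM_equal_borel)
  ultimately have "(\<lambda>x. x) -` K \<inter> space (Pi\<^sub>M {..<n} (\<lambda>_. lborel)) \<in> sets (Pi\<^sub>M {..<n} (\<lambda>_. lborel))"
    by (rule measurable_sets)
  moreover have "(\<lambda>x. x) -` K \<inter> space (Pi\<^sub>M {..<n} (\<lambda>_. lborel)) = K"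
    using assms(2) by (auto simp: space_PiM E_space_def)
  ultimately show ?thesis by simp
qed

lemma sets_pullback_U_body:
  assumes "hyperplane_ident n \<phi>"
  shows "pullback n \<phi> (U_body n) \<in> sets (Pi\<^sub>M {..<n} (\<lambda>_. lborel))"
proof -
  let ?H = "ones_perp (Suc n)" and ?d = "\<lambda>x y. E_norm (Suc n) (E_diff (Suc n) x y)"
  define \<psi> where "\<psi> = inv_into (E_space n) \<phi>"
  have im: "\<phi> ` E_space n = ?H"
    and iso: "\<And>x y. x \<in> E_space n \<Longrightarrow> y \<in> E_space n \<Longrightarrow> ?d (\<phi> x) (\<phi> y) = E_norm n (E_diff n x y)"
    using assms by (auto simp: hyperplane_ident_def)
  have \<psi>: "\<psi> y \<in> E_space n" "\<phi> (\<psi> y) = y" if "y \<in> ?H" for y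
    using that im by (auto simp: \<psi>_def inv_into_into f_inv_into_f)
  have lip: "\<bar>\<psi> x i - \<psi> y i\<bar> \<le> ?d x y" if "x \<in> ?H" "y \<in> ?H" "i < n" for x y i
    using coord_le_E_norm [of i n "E_diff n (\<psi> x) (\<psi> y)"] iso [of "\<psi> x" "\<psi> y"] \<psi> that
    by (simp add: E_diff_def)
  have "continuous_on ?H \<psi>"
  proof (rule continuous_on_coordinatewise_then_product)
    fix i
    show "continuous_on ?H (\<lambda>y. \<psi> y i)"
    proof (cases "i < n")
      case True
      show ?thesis unfolding continuous_on_def
      proof
        fix y assume y: "y \<in> ?H"
        have "continuous_on ?H (\<lambda>x. ?d x y)"
          unfolding E_diff_def
          by (intro continuous_E_norm continuous_restrict_fun [where f = "\<lambda>x i. x i - y i"]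
              continuous_on_diff continuous_coord continuous_on_const continuous_on_id)
        then have "((\<lambda>x. ?d x y) \<longlongrightarrow> ?d y y) (at y within ?H)"
          using y by (auto simp: continuous_on_def)
        moreover have "?d y y = 0" by (simp add: E_norm_def L2_set_def E_diff_def)
        ultimately have "((\<lambda>x. ?d x y) \<longlongrightarrow> 0) (at y within ?H)" by simp
        moreover have "\<forall>\<^sub>F x in at y within ?H. norm (\<psi> x i - \<psi> y i) \<le> ?d x y"
          using lip [OF _ y True] by (auto simp: eventually_at_topological)
        ultimately have "((\<lambda>x. \<psi> x i - \<psi> y i) \<longlongrightarrow> 0) (at y within ?H)"
          by (rule Lim_null_comparison [rotated])
        then show "((\<lambda>x. \<psi> x i) \<longlongrightarrow> \<psi> y i) (at y within ?H)" by (rule LIM_zero_cancel)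
      qed
    next
      case False
      then have "\<psi> y i = undefined" if "y \<in> ?H" for y
        using \<psi>(1) [OF that] by (auto simp: E_space_def PiE_def extensional_def)
      then show ?thesis by (subst continuous_on_cong [where g = "\<lambda>_. undefined"]) auto
    qed
  qed
  moreover have U: "U_body n \<subseteq> ?H"
    using is_orth_proj_ones_perp [of "Suc n"] orth_proj_ones_perp [of "Suc n"]
    by (auto simp: U_body_def is_orth_proj_def)
  ultimately have "compact (\<psi> ` U_body n)"
    by (intro compact_continuous_image compact_U_body) (rule continuous_on_subset)
  moreover have "inj_on \<phi> (E_space n)"
  proof
    fix x y assume xy: "x \<in> E_space n" "y \<in> E_space n" "\<phi> x = \<phi> y"
    then have "E_norm n (E_diff n x y) = 0"
      using iso [of x y] by (simp add: E_norm_def L2_set_def E_diff_def)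
    then have "x i = y i" if "i < n" for i
      using coord_le_E_norm [OF that, of "E_diff n x y"] that by (simp add: E_diff_def)
    then show "x = y" using xy by (intro PiE_ext) (auto simp: E_space_def)
  qed
  then have "pullback n \<phi> (U_body n) = \<psi> ` U_body n"
    using \<psi> U by (force simp: pullback_def \<psi>_def)
  moreover have "pullback n \<phi> (U_body n) \<subseteq> E_space n" by (auto simp: pullback_def)
  ultimately show ?thesis
    by (metis sets_E_space compact_imp_closed)
qed

end

theory Submission
  imports Defs "HOL-Probability.Distributions"
begin

text \<open>
  A point of \<open>M_body m\<close> has positive part of norm \<open>a\<close> and negative part of norm \<open>b\<close> with
  \<open>a\<^sup>2 + (b + sqrt 2)\<^sup>2 \<le> 4\<close>, which implies \<open>a powr (2/3) + b powr (2/3) \<le> 1.4696\<close>. By a Chernoff bound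
  with a product of two-sided Gaussians, the set where the two norms are at most \<open>a\<close> and \<open>b\<close> has
  volume at most \<open>(sqrt (pi * e / (2 * m)) * S powr (3/2)) ^ m\<close> with \<open>S = a powr (2/3) + b powr (2/3)\<close>, that is,
  up to a polynomial factor, the volume of the ball of radius \<open>S powr (3/2) / 2\<close>. A fixed finite number
  of such sets with \<open>S \<le> 1.4698\<close> covers a neighbourhood of \<open>M_body m\<close>, whatever \<open>m\<close> is, and
  \<open>1.4698 powr (3/2) / 2 < 0.891\<close>.

  The projection costs only a factor \<open>O(1 / \<epsilon>)\<close> times a ratio of unit ball volumes in dimensions
  \<open>n\<close> and \<open>n + 1\<close>: count pairs of a point of \<open>U_body n\<close> and a point of the \<open>\<epsilon>\<close>-neighbourhood
  of \<open>M_body (n + 1)\<close> whose projection is \<open>\<epsilon>\<close>-close to it.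
\<close>

abbreviation Leb :: "nat \<Rightarrow> vect measure" where
  "Leb n \<equiv> Pi\<^sub>M {..<n} (\<lambda>_. lborel)"

section \<open>The extremal problem for the two norms\<close>

text \<open>With \<open>s\<close> and \<open>t\<close> the cube roots of the norms of the two parts,
  the exponents \<open>2/3\<close> disappear and the maximisation becomes a polynomial problem. The
  true maximum lies just below \<open>1.4696\<close>.\<close>

lemma cube_root_profile_bound:
  fixes s t :: real
  assumes s: "0 \<le> s" and t: "0 \<le> t" and le: "(s ^ 3)\<^sup>2 + (t ^ 3 + sqrt 2)\<^sup>2 \<le> 4"
  shows "s\<^sup>2 + t\<^sup>2 \<le> 1.4696"
proof -
  \<comment> \<open>comparing cubes, the claim becomes a quartic inequality in \<open>t\<close>: the terms \<open>t ^ 6\<close> cancel\<close>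
  have r2: "1.4142 \<le> sqrt 2" by (rule real_le_rsqrt) (simp add: power2_eq_square)
  have t3: "t ^ 3 * 1.4142 \<le> t ^ 3 * sqrt 2"
    using t r2 by (intro mult_left_mono) auto
  have s6: "(s\<^sup>2) ^ 3 \<le> 2 - 2.8284 * t ^ 3 - t ^ 6"
    using le t3 by (simp add: power2_eq_square algebra_simps eval_nat_numeral)
  have t6: "0 \<le> (s\<^sup>2) ^ 3" "0 \<le> t ^ 6" by simp_all
  \<comment> \<open>The crude bound \<open>t \<le> 1\<close> makes \<open>1.4696 - t\<^sup>2\<close>
    nonnegative, so that the final inequality between cubes can be undone.\<close>
  have "2.8284 * t ^ 3 \<le> 2" using s6 t6 by linarith
  then have "t ^ 3 \<le> 1 ^ 3" by simp
  then have t1: "t \<le> 1" by (rule power_mono_iff[THEN iffD1, rotated 3]) (use t in simp_all)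
  then have t2: "t\<^sup>2 \<le> 1" using t by (simp add: power_le_one)
  \<comment> \<open>a sum-of-squares certificate, nearly tight at the maximiser, which is close to \<open>t = 0.65\<close>\<close>
  have "0 \<le> 4.4088 * ((t - 0.65)\<^sup>2 * t\<^sup>2) + 8.55984 * ((t - 0.65)\<^sup>2 * t) + 2.7858 * (t - 3.6165324 / 5.5716)\<^sup>2"
    using t by (intro add_nonneg_nonneg mult_nonneg_nonneg) auto
  moreover have "(t - 0.65)\<^sup>2 * t\<^sup>2 = t ^ 4 - 1.3 * t ^ 3 + 0.4225 * t\<^sup>2"
    "(t - 0.65)\<^sup>2 * t = t ^ 3 - 1.3 * t\<^sup>2 + 0.4225 * t"
    "(t - 3.6165324 / 5.5716)\<^sup>2 = t\<^sup>2 - 2 * (3.6165324 / 5.5716) * t + (3.6165324 / 5.5716)\<^sup>2"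
    "(1.4696 - t\<^sup>2) ^ 3 = 1.4696 ^ 3 - 3 * 1.4696\<^sup>2 * t\<^sup>2 + 3 * 1.4696 * t ^ 4 - t ^ 6"
    by algebra+
  \<comment> \<open>The certificate agrees with the target exactly in degrees 1, 3 and 4; the slack
    from rounding in degrees 0 and 2 is covered by the next two numerical facts.\<close>
  moreover have "(3.6165324 / 5.5716 :: real)\<^sup>2 * 2.7858 + 2 \<le> 1.4696 ^ 3"
    by (simp add: power2_eq_square eval_nat_numeral)
  moreover have "3 * (1.4696 :: real)\<^sup>2 + 4.4088 * 0.4225 \<le> 8.55984 * 1.3 - 2.7858"
    by (simp add: power2_eq_square)
  then have "3 * 1.4696\<^sup>2 * t\<^sup>2 \<le> (8.55984 * 1.3 - 2.7858 - 4.4088 * 0.4225) * t\<^sup>2"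
    by (intro mult_right_mono) auto
  moreover have "0 \<le> t\<^sup>2" by simp
  ultimately have "2 - 2.8284 * t ^ 3 - t ^ 6 \<le> (1.4696 - t\<^sup>2) ^ 3"
    by (simp add: algebra_simps)
  then have "(s\<^sup>2) ^ 3 \<le> (1.4696 - t\<^sup>2) ^ 3" using s6 by linarith
  then have "s\<^sup>2 \<le> 1.4696 - t\<^sup>2"
    by (rule power_mono_iff[THEN iffD1, rotated 3]) (use t2 in simp_all)
  then show ?thesis by simp
qed

section \<open>Gaussian integrals and a Stirling bound\<close>

text \<open>Both parts rescale the standard half-line integral by \<open>c = sqrt h\<close> or
  \<open>c = - sqrt h\<close>; the sign of \<open>c\<close> selects the half-line.\<close>

lemma nn_integral_gaussian_half_line:
  assumes h: "0 < h"
  shows "(\<integral>\<^sup>+x. ennreal (indicator {0..} x * exp (- h * x\<^sup>2)) \<partial>lborel) = ennreal (sqrt (pi / h) / 2)"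
    and "(\<integral>\<^sup>+x. ennreal (indicator {0..} (- x) * exp (- h * x\<^sup>2)) \<partial>lborel) = ennreal (sqrt (pi / h) / 2)"
proof -
  let ?g = "\<lambda>x::real. ennreal (indicator {0..} x * exp (- x\<^sup>2))"
  have "integrable lborel (\<lambda>x::real. indicator {0..} x * exp (- x\<^sup>2))"
    and "(LBINT x::real. indicator {0..} x * exp (- x\<^sup>2)) = sqrt pi / 2"
    using gaussian_moment_0 by (auto simp: has_bochner_integral_iff)
  then have g: "(\<integral>\<^sup>+x. ?g x \<partial>lborel) = ennreal (sqrt pi / 2)"
    by (subst nn_integral_eq_integral) auto
  have scale: "(\<integral>\<^sup>+x. ?g (0 + c * x) \<partial>lborel) = ennreal (sqrt (pi / h) / 2)" if c: "\<bar>c\<bar> = sqrt h" for c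
  proof -
    have c0: "c \<noteq> 0" and c1: "0 < \<bar>c\<bar>" using h c by auto
    have "ennreal (sqrt pi / 2) = ennreal \<bar>c\<bar> * (\<integral>\<^sup>+x. ?g (0 + c * x) \<partial>lborel)"
      unfolding g[symmetric] by (rule nn_integral_real_affine[OF _ c0]) measurable
    moreover have "ennreal (1 / \<bar>c\<bar>) * ennreal \<bar>c\<bar> = 1"
      using c0 by (simp add: ennreal_mult[symmetric])
    ultimately have "ennreal (1 / \<bar>c\<bar>) * ennreal (sqrt pi / 2) = (\<integral>\<^sup>+x. ?g (0 + c * x) \<partial>lborel)"
      by (simp only: mult.assoc[symmetric] mult_1)
    moreover have "ennreal (1 / \<bar>c\<bar>) * ennreal (sqrt pi / 2) = ennreal (sqrt (pi / h) / 2)"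
      unfolding c using h by (subst ennreal_mult[symmetric]) (auto simp: real_sqrt_divide mult.commute)
    ultimately show ?thesis by (simp only:)
  qed
  show "(\<integral>\<^sup>+x. ennreal (indicator {0..} x * exp (- h * x\<^sup>2)) \<partial>lborel) = ennreal (sqrt (pi / h) / 2)"
    using h by (subst scale[of "sqrt h", symmetric])
      (auto intro!: nn_integral_cong simp: indicator_def power_mult_distrib zero_le_mult_iff)
  show "(\<integral>\<^sup>+x. ennreal (indicator {0..} (- x) * exp (- h * x\<^sup>2)) \<partial>lborel) = ennreal (sqrt (pi / h) / 2)"
    using h by (subst scale[of "- sqrt h", symmetric])
      (auto intro!: nn_integral_cong simp: indicator_def power_mult_distrib mult_le_0_iff)
qed

text \<open>Stirling with the factor \<open>x\<close> in place of its square root: polynomial losses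
  are harmless later, and this choice reduces the step from \<open>x\<close> to \<open>x + 1\<close>
  to \<open>ln y \<le> y - 1\<close>. Induction over \<open>m\<close> in steps of 2 keeps the
  quotient of the two sides from growing, so \<open>C\<close> is the larger of its values at
  \<open>m = 1\<close> and \<open>m = 2\<close>.\<close>

lemma Gamma_le_powr:
  "\<exists>C>0. \<forall>m\<ge>1. Gamma (real m / 2 + 1) \<le> C * (real m / 2) * (real m / 2 / exp 1) powr (real m / 2)"
proof -
  define f where "f x = x * (x / exp 1) powr x" for x :: real
  have f: "f x > 0" if "x > 0" for x using that by (simp add: f_def)
  have step: "(x + 1) * f x \<le> f (x + 1)" if x: "x > 0" for x :: real
  proof -
    have "ln (x / (x + 1)) \<le> x / (x + 1) - 1" using x by (intro ln_le_minus_one) auto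
    then have "1 / (x + 1) \<le> ln (x + 1) - ln x" using x by (simp add: ln_div field_simps)
    then have 1: "1 \<le> (x + 1) * (ln (x + 1) - ln x)" using x by (simp add: field_simps)
    have e: "(y / exp 1) powr y = exp (y * ln y - y)" if "y > 0" for y :: real
      using that by (simp add: powr_def ln_div algebra_simps)
    have "x * exp (x * ln x - x) = exp (ln x + (x * ln x - x))" using x by (simp add: exp_add)
    also have "\<dots> \<le> exp ((x + 1) * ln (x + 1) - (x + 1))" using 1 by (simp add: algebra_simps)
    finally show ?thesis using x e[of x] e[of "x + 1"] by (simp add: f_def)
  qed
  define C where "C = max (Gamma (3/2) / f (1/2)) (Gamma 2 / f 1)"
  have C0: "C > 0" unfolding C_def using f by (simp add: less_max_iff_disj)
  have "Gamma (real m / 2 + 1) \<le> C * f (real m / 2)" if "m \<ge> 1" for m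
    using that
  proof (induction m rule: less_induct)
    case (less m)
    consider "m = 1" | "m = 2" | k where "m = k + 2" "k \<ge> 1"
      using less.prems that(3)[of "m - 2"] by (cases "m \<ge> 3") force+
    then show ?case
    proof cases
      case 1
      have "Gamma (3/2) / f (1/2) \<le> C" by (simp add: C_def)
      then show ?thesis using 1 f[of "1/2"] by (simp add: field_simps)
    next
      case 2
      have "Gamma 2 / f 1 \<le> C" by (simp add: C_def)
      then show ?thesis using 2 f[of 1] by (simp add: field_simps)
    next
      case 3
      define x where "x = real k / 2"
      have x: "x > 0" using 3 by (simp add: x_def)
      have m: "real m / 2 = x + 1" using 3 by (simp add: x_def field_simps)
      have "Gamma (x + 1 + 1) = (x + 1) * Gamma (x + 1)"
        using x by (subst Gamma_plus1) (auto elim!: nonpos_Ints_cases)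
      also have "\<dots> \<le> (x + 1) * (C * f x)"
        using less.IH[of k] 3 x by (intro mult_left_mono) (auto simp: x_def)
      also have "\<dots> \<le> C * f (x + 1)" using mult_left_mono[OF step[OF x], of C] C0 by (simp add: algebra_simps)
      finally show ?thesis unfolding m .
    qed
  qed
  then show ?thesis using C0 by (auto simp: f_def mult.assoc)
qed

section \<open>Translations, balls and measurability in the product measure\<close>

lemma distr_Leb_translate:
  "distr (Leb n) (Leb n) (\<lambda>x. \<lambda>i\<in>{..<n}. x i - z i) = Leb n"
proof -
  interpret product_sigma_finite "\<lambda>_::nat. lborel :: real measure" by standard
  have meas[measurable]: "(\<lambda>x. \<lambda>i\<in>{..<n}. x i - z i) \<in> measurable (Leb n) (Leb n)"
    by (intro measurable_restrict) (simp, measurable)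
  show ?thesis
  proof (rule PiM_eqI)
    fix A :: "nat \<Rightarrow> real set" assume A: "\<And>i. i \<in> {..<n} \<Longrightarrow> A i \<in> sets lborel"
    have "(\<lambda>x. \<lambda>i\<in>{..<n}. x i - z i) -` Pi\<^sub>E {..<n} A \<inter> space (Leb n)
        = Pi\<^sub>E {..<n} (\<lambda>i. (\<lambda>x. x - z i) -` A i)"
      by (auto simp: space_PiM PiE_iff)
    moreover have "emeasure lborel ((\<lambda>x. x - z i) -` A i) = emeasure lborel (A i)" if "i < n" for i
    proof -
      have "emeasure lborel (A i) = emeasure (distr lborel borel ((+) (- z i))) (A i)"
        by (simp add: lborel_distr_plus)
      also have "\<dots> = emeasure lborel ((\<lambda>x. x - z i) -` A i)"
        using A[of i] that by (subst emeasure_distr) (auto simp: vimage_def)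
      finally show ?thesis by simp
    qed
    moreover have "(\<lambda>x. x - z i) -` A i \<in> sets lborel" if "i < n" for i
      using A[of i] that measurable_sets_borel[of "\<lambda>x. x - z i" borel "A i"] by simp
    moreover have "emeasure (Leb n) (Pi\<^sub>E {..<n} (\<lambda>i. (\<lambda>x. x - z i) -` A i))
        = (\<Prod>i<n. emeasure lborel ((\<lambda>x. x - z i) -` A i))"
      using calculation(3) by (intro emeasure_PiM) auto
    moreover have "Pi\<^sub>E {..<n} A \<in> sets (Leb n)"
      using A by (intro sets_PiM_I_finite) auto
    ultimately show "emeasure (distr (Leb n) (Leb n) (\<lambda>x. \<lambda>i\<in>{..<n}. x i - z i)) (Pi\<^sub>E {..<n} A)
        = (\<Prod>i<n. emeasure lborel (A i))"
      by (subst emeasure_distr) auto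
  qed simp_all
qed

lemma measurable_E_norm [measurable (raw)]:
  assumes "\<And>i. i < n \<Longrightarrow> (\<lambda>x. f x i) \<in> borel_measurable N"
  shows "(\<lambda>x. E_norm n (f x)) \<in> borel_measurable N"
  unfolding E_norm_def L2_set_def using assms
  by (intro borel_measurable_sum borel_measurable_power measurable_compose[OF _ borel_measurable_sqrt]) auto

lemma measurable_Leb_component:
  "i < n \<Longrightarrow> (\<lambda>x. x i) \<in> borel_measurable (Leb n)"
  using measurable_component_singleton[of i "{..<n}" "\<lambda>_. lborel :: real measure"] by simp

lemma space_Leb: "space (Leb n) = E_space n"
  by (simp add: space_PiM E_space_def)

lemma emeasure_Leb_ball:
  assumes "r > 0"
  shows "emeasure (Leb n) (E_ball n r) = ennreal (unit_ball_vol (real n) * r ^ n)"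
    and "emeasure (Leb n) {x \<in> E_space n. E_norm n (E_diff n x z) \<le> r} = emeasure (Leb n) (E_ball n r)"
    and "E_ball n r \<in> sets (Leb n)"
    and "{x \<in> E_space n. E_norm n (E_diff n x z) \<le> r} \<in> sets (Leb n)"
proof -
  have "E_ball n r = {f. sqrt (\<Sum>i\<in>{..<n}. (f i)\<^sup>2) \<le> r} \<inter> space (Leb n)"
    by (auto simp: E_ball_def space_Leb E_norm_def L2_set_def)
  then show "emeasure (Leb n) (E_ball n r) = ennreal (unit_ball_vol (real n) * r ^ n)"
    using emeasure_cball_aux[of "{..<n}" r] assms by simp
  note [measurable] = measurable_Leb_component
  have "{x \<in> space (Leb n). E_norm n x \<le> r} \<in> sets (Leb n)"
    by measurable
  then show B: "E_ball n r \<in> sets (Leb n)"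
    by (simp add: E_ball_def space_Leb)
  have meas: "(\<lambda>x. \<lambda>i\<in>{..<n}. x i - z i) \<in> measurable (Leb n) (Leb n)"
    by (intro measurable_restrict) (simp, measurable)
  have eq: "(\<lambda>x. \<lambda>i\<in>{..<n}. x i - z i) -` E_ball n r \<inter> space (Leb n)
      = {x \<in> E_space n. E_norm n (E_diff n x z) \<le> r}"
    by (auto simp: E_ball_def space_Leb E_diff_def E_space_def)
  show "emeasure (Leb n) {x \<in> E_space n. E_norm n (E_diff n x z) \<le> r} = emeasure (Leb n) (E_ball n r)"
    using emeasure_distr[OF meas B] by (simp add: distr_Leb_translate eq)
  show "{x \<in> E_space n. E_norm n (E_diff n x z) \<le> r} \<in> sets (Leb n)"
    using measurable_sets[OF meas B] by (simp add: eq)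
qed

text \<open>Such a function is continuous for the product topology, so its sublevel sets are closed
  and \<open>sets_E_space\<close> applies. This handles the coordinates of an arbitrary isometry
  \<open>\<phi>\<close>, for which no formula is available.\<close>

lemma measurable_lipschitz_Leb:
  assumes lip: "\<And>x y. x \<in> E_space n \<Longrightarrow> y \<in> E_space n \<Longrightarrow> \<bar>f x - f y\<bar> \<le> E_norm n (E_diff n x y)"
  shows "f \<in> borel_measurable (Leb n)"
proof -
  have E: "closed (E_space n)"
  proof -
    have "E_space n = (\<Inter>i\<in>{n..}. {x. x i = undefined})"
      by (rule set_eqI) (simp add: E_space_def PiE_iff extensional_def not_less, auto)
    also have "closed \<dots>"
      by (intro closed_INT ballI closed_Collect_eq continuous_coord continuous_on_id continuous_on_const)
    finally show ?thesis .
  qed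
  have "continuous_on (E_space n) f"
    unfolding continuous_on_def
  proof
    fix y assume y: "y \<in> E_space n"
    let ?d = "\<lambda>x. E_norm n (E_diff n x y)"
    have "continuous_on (E_space n) ?d"
      unfolding E_diff_def
      by (intro continuous_E_norm continuous_restrict_fun [where f = "\<lambda>x i. x i - y i"]
          continuous_on_diff continuous_coord continuous_on_const continuous_on_id)
    then have "(?d \<longlongrightarrow> ?d y) (at y within E_space n)"
      using y by (auto simp: continuous_on_def)
    moreover have "?d y = 0" by (simp add: E_norm_def L2_set_def E_diff_def)
    ultimately have "(?d \<longlongrightarrow> 0) (at y within E_space n)" by simp
    moreover have "\<forall>\<^sub>F x in at y within E_space n. norm (f x - f y) \<le> ?d x"
      using lip [OF _ y] by (auto simp: eventually_at_topological)
    ultimately have "((\<lambda>x. f x - f y) \<longlongrightarrow> 0) (at y within E_space n)"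
      by (rule Lim_null_comparison [rotated])
    then show "(f \<longlongrightarrow> f y) (at y within E_space n)" by (rule LIM_zero_cancel)
  qed
  then have "closed (E_space n \<inter> f -` {..a})" for a
    using E by (rule continuous_closed_preimage) simp
  then have "E_space n \<inter> f -` {..a} \<in> sets (Leb n)" for a
    by (rule sets_E_space) auto
  then show ?thesis
    by (intro borel_measurableI_le) (simp add: space_Leb vimage_def Int_def)
qed

section \<open>Volume of a projection by double counting\<close>

text \<open>Projecting subtracts the mean \<open>c\<close> from every coordinate of the difference,
  which lowers the sum of squares by \<open>real m * c\<^sup>2\<close>.\<close>

lemma E_norm_orth_proj_le:
  assumes "m > 0"
  shows "E_norm m (E_diff m (orth_proj m (ones_perp m) x) (orth_proj m (ones_perp m) y)) \<le> E_norm m (E_diff m x y)"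
proof -
  define d where "d i = x i - y i" for i
  define c where "c = (\<Sum>j<m. d j) / real m"
  have c: "(\<Sum>j<m. d j) = real m * c" using assms by (simp add: c_def)
  have "(\<Sum>i<m. (E_diff m (orth_proj m (ones_perp m) x) (orth_proj m (ones_perp m) y) i)\<^sup>2) = (\<Sum>i<m. (d i - c)\<^sup>2)"
    by (intro sum.cong)
      (auto simp: E_diff_def orth_proj_ones_perp[OF assms] d_def c_def sum_subtractf diff_divide_distrib algebra_simps)
  also have "\<dots> = (\<Sum>i<m. (d i)\<^sup>2 - 2 * c * d i + c\<^sup>2)"
    by (intro sum.cong) (auto simp: power2_eq_square algebra_simps)
  also have "\<dots> = (\<Sum>i<m. (d i)\<^sup>2) - real m * c\<^sup>2"
    by (simp add: sum.distrib sum_subtractf sum_distrib_left[symmetric] c power2_eq_square)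
  also have "\<dots> \<le> (\<Sum>i<m. (d i)\<^sup>2)" by simp
  also have "\<dots> = (\<Sum>i<m. (E_diff m x y i)\<^sup>2)"
    by (intro sum.cong) (auto simp: E_diff_def d_def)
  finally show ?thesis by (simp add: E_norm_def L2_set_def)
qed

lemma hyperplane_ident_measurable:
  assumes "hyperplane_ident n \<phi>" "i < Suc n"
  shows "(\<lambda>x. \<phi> x i) \<in> borel_measurable (Leb n)"
proof (rule measurable_lipschitz_Leb)
  fix x y assume "x \<in> E_space n" "y \<in> E_space n"
  then have "E_norm (Suc n) (E_diff (Suc n) (\<phi> x) (\<phi> y)) = E_norm n (E_diff n x y)"
    using assms(1) by (simp add: hyperplane_ident_def)
  then show "\<bar>\<phi> x i - \<phi> y i\<bar> \<le> E_norm n (E_diff n x y)"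
    using coord_le_E_norm[OF assms(2), of "E_diff (Suc n) (\<phi> x) (\<phi> y)"] assms(2)
    by (simp add: E_diff_def)
qed

text \<open>
  Double counting of the pairs \<open>(x, y)\<close> for which \<open>\<phi> x\<close> and the projection of \<open>y\<close> are at distance
  at most \<open>\<epsilon>\<close>: for fixed \<open>x\<close> the points \<open>y \<in> W\<close> fill at least a ball, and for fixed \<open>y\<close> the
  points \<open>x\<close> fill exactly a ball.
\<close>

lemma emeasure_pullback_projection_le:
  assumes \<phi>: "hyperplane_ident n \<phi>" and \<epsilon>: "0 < \<epsilon>"
    and X: "pullback n \<phi> (orth_proj (Suc n) (ones_perp (Suc n)) ` S) \<in> sets (Leb n)"
    and W: "W \<in> sets (Leb (Suc n))"
    and nbhd: "\<And>z y. z \<in> S \<Longrightarrow> y \<in> E_space (Suc n) \<Longrightarrow> E_norm (Suc n) (E_diff (Suc n) y z) \<le> \<epsilon> \<Longrightarrow> y \<in> W"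
  shows "emeasure (Leb (Suc n)) (E_ball (Suc n) \<epsilon>)
           * emeasure (Leb n) (pullback n \<phi> (orth_proj (Suc n) (ones_perp (Suc n)) ` S))
         \<le> emeasure (Leb n) (E_ball n \<epsilon>) * emeasure (Leb (Suc n)) W"
proof -
  define m where "m = Suc n"
  define P where "P = orth_proj m (ones_perp m)"
  define X where "X = pullback n \<phi> (P ` S)"
  define R where "R = {(x, y) \<in> space (Leb n \<Otimes>\<^sub>M Leb m). x \<in> X \<and> y \<in> W \<and> E_norm m (E_diff m (\<phi> x) (P y)) \<le> \<epsilon>}"
  define f where "f x y = (indicator R (x, y) :: ennreal)" for x y
  have P: "P y \<in> ones_perp m" for y
    using is_orth_proj_ones_perp[of m] orth_proj_ones_perp[of m]
    by (auto simp: P_def m_def is_orth_proj_def)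
  have im: "\<phi> ` E_space n = ones_perp m"
    and iso: "\<And>x y. x \<in> E_space n \<Longrightarrow> y \<in> E_space n \<Longrightarrow>
        E_norm m (E_diff m (\<phi> x) (\<phi> y)) = E_norm n (E_diff n x y)"
    using \<phi> by (auto simp: hyperplane_ident_def m_def)
  interpret product_sigma_finite "\<lambda>_::nat. lborel :: real measure" by standard
  interpret pair_sigma_finite "Leb n" "Leb m"
    by (intro pair_sigma_finite.intro sigma_finite) auto
  have X_sets[measurable]: "X \<in> sets (Leb n)" using X by (simp add: X_def P_def m_def)
  have W_sets[measurable]: "W \<in> sets (Leb m)" using W by (simp add: m_def)
  have \<phi>_meas[measurable]: "(\<lambda>x. \<phi> x i) \<in> borel_measurable (Leb n)" if "i < m" for i
    using hyperplane_ident_measurable[OF \<phi>] that by (simp add: m_def)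
  have P_meas[measurable]: "(\<lambda>y. P y i) \<in> borel_measurable (Leb m)" if "i < m" for i
  proof -
    note [measurable] = measurable_Leb_component
    show ?thesis using that by (simp add: P_def orth_proj_ones_perp) measurable
  qed
  have dist_meas: "(\<lambda>z. E_norm m (E_diff m (\<phi> (fst z)) (P (snd z)))) \<in> borel_measurable (Leb n \<Otimes>\<^sub>M Leb m)"
  proof (rule measurable_E_norm)
    fix i assume i: "i < m"
    have "(\<lambda>z. \<phi> (fst z) i - P (snd z) i) \<in> borel_measurable (Leb n \<Otimes>\<^sub>M Leb m)"
      using measurable_compose[OF measurable_fst \<phi>_meas[OF i]] measurable_compose[OF measurable_snd P_meas[OF i]]
      by (intro borel_measurable_diff)
    then show "(\<lambda>z. E_diff m (\<phi> (fst z)) (P (snd z)) i) \<in> borel_measurable (Leb n \<Otimes>\<^sub>M Leb m)"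
      using i by (simp add: E_diff_def)
  qed
  note [measurable] = dist_meas
  have "R = {z \<in> space (Leb n \<Otimes>\<^sub>M Leb m). fst z \<in> X \<and> snd z \<in> W \<and> E_norm m (E_diff m (\<phi> (fst z)) (P (snd z))) \<le> \<epsilon>}"
    by (auto simp: R_def)
  also have "\<dots> \<in> sets (Leb n \<Otimes>\<^sub>M Leb m)" by measurable
  finally have R_sets: "R \<in> sets (Leb n \<Otimes>\<^sub>M Leb m)" .
  then have f_meas: "case_prod f \<in> borel_measurable (Leb n \<Otimes>\<^sub>M Leb m)"
    by (simp add: f_def case_prod_unfold)
  have XE: "X \<subseteq> E_space n" by (auto simp: X_def pullback_def)
  have "emeasure (Leb m) (E_ball m \<epsilon>) * emeasure (Leb n) X
      = (\<integral>\<^sup>+x. emeasure (Leb m) (E_ball m \<epsilon>) * indicator X x \<partial>Leb n)"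
    by (simp add: nn_integral_cmult)
  also have "\<dots> \<le> (\<integral>\<^sup>+x. \<integral>\<^sup>+y. f x y \<partial>Leb m \<partial>Leb n)"
  proof (intro nn_integral_mono)
    fix x
    show "emeasure (Leb m) (E_ball m \<epsilon>) * indicator X x \<le> (\<integral>\<^sup>+y. f x y \<partial>Leb m)"
    proof (cases "x \<in> X")
      case True
      then obtain z where z: "z \<in> S" "\<phi> x = P z" by (auto simp: X_def pullback_def)
      \<comment> \<open>The whole ball around the preimage \<open>z\<close> lies in the fibre of
        \<open>R\<close> over \<open>x\<close>: \<open>nbhd\<close> puts it inside \<open>W\<close>,
        and projecting does not increase distances.\<close>
      let ?B = "{y \<in> E_space m. E_norm m (E_diff m y z) \<le> \<epsilon>}"
      have "E_norm m (E_diff m (P z) (P y)) \<le> \<epsilon>" if "y \<in> ?B" for y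
      proof -
        have "E_norm m (E_diff m z y) = E_norm m (E_diff m y z)"
          by (simp add: E_norm_def L2_set_def E_diff_def power2_commute)
        then show ?thesis
          using that E_norm_orth_proj_le[of m z y] by (simp add: P_def m_def)
      qed
      then have "?B \<subseteq> {y. (x, y) \<in> R}"
        using True z nbhd[OF z(1)] XE by (auto simp: R_def space_pair_measure space_Leb m_def)
      then have "(\<integral>\<^sup>+y. indicator ?B y \<partial>Leb m) \<le> (\<integral>\<^sup>+y. f x y \<partial>Leb m)"
        by (intro nn_integral_mono) (auto simp: f_def indicator_def)
      then show ?thesis
        using True emeasure_Leb_ball(2,4)[OF \<epsilon>, of m z] by simp
    qed simp
  qed
  also have "\<dots> = (\<integral>\<^sup>+y. \<integral>\<^sup>+x. f x y \<partial>Leb n \<partial>Leb m)"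
    using Fubini'[OF f_meas] by simp
  also have "\<dots> \<le> (\<integral>\<^sup>+y. emeasure (Leb n) (E_ball n \<epsilon>) * indicator W y \<partial>Leb m)"
  proof (intro nn_integral_mono)
    fix y
    \<comment> \<open>As \<open>\<phi>\<close> maps onto the hyperplane, \<open>P y\<close> is some
      \<open>\<phi> x0\<close>, and the isometry places the fibre over \<open>y\<close> inside a
      ball around \<open>x0\<close>.\<close>
    obtain x0 where x0: "x0 \<in> E_space n" "\<phi> x0 = P y" using P[of y] im by (metis imageE)
    let ?B = "{x \<in> E_space n. E_norm n (E_diff n x x0) \<le> \<epsilon>}"
    have "f x y \<le> indicator ?B x * indicator W y" for x
      using iso[of x x0] x0 by (auto simp: f_def R_def indicator_def space_pair_measure space_Leb)
    then have "(\<integral>\<^sup>+x. f x y \<partial>Leb n) \<le> (\<integral>\<^sup>+x. indicator ?B x * indicator W y \<partial>Leb n)"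
      by (intro nn_integral_mono)
    also have "\<dots> = emeasure (Leb n) (E_ball n \<epsilon>) * indicator W y"
      using emeasure_Leb_ball(2,4)[OF \<epsilon>, of n x0] by (simp add: nn_integral_multc)
    finally show "(\<integral>\<^sup>+x. f x y \<partial>Leb n) \<le> emeasure (Leb n) (E_ball n \<epsilon>) * indicator W y" .
  qed
  also have "\<dots> = emeasure (Leb n) (E_ball n \<epsilon>) * emeasure (Leb m) W"
    by (simp add: nn_integral_cmult)
  finally show ?thesis by (simp add: X_def P_def m_def)
qed

section \<open>Volume of the sets with bounded positive and negative parts\<close>

text \<open>On each orthant this is a product of orthant parts of two balls. Both constraints are
  sums over coordinates once squared, so a product of functions of one coordinate can dominate the
  indicator.\<close>

definition sign_box :: "nat \<Rightarrow> real \<Rightarrow> real \<Rightarrow> vect set" where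
  "sign_box m a b = {z \<in> E_space m.
     L2_set (\<lambda>i. max 0 (z i)) {..<m} \<le> a \<and> L2_set (\<lambda>i. max 0 (- z i)) {..<m} \<le> b}"

lemma sets_sign_box: "sign_box m a b \<in> sets (Leb m)"
proof -
  have L: "(\<lambda>z. L2_set (\<lambda>i. f (z i)) {..<m}) \<in> borel_measurable (Leb m)"
    if [measurable]: "f \<in> borel_measurable borel" for f :: "real \<Rightarrow> real"
    using measurable_E_norm[of m "\<lambda>z i. f (z i)" "Leb m"]
      measurable_compose[OF measurable_Leb_component that]
    by (simp add: E_norm_def)
  have [measurable]: "(\<lambda>z. L2_set (\<lambda>i. max 0 (z i)) {..<m}) \<in> borel_measurable (Leb m)"
    "(\<lambda>z. L2_set (\<lambda>i. max 0 (- z i)) {..<m}) \<in> borel_measurable (Leb m)"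
    using L[of "\<lambda>x. max 0 x"] L[of "\<lambda>x. max 0 (- x)"] by simp_all
  have "{z \<in> space (Leb m). L2_set (\<lambda>i. max 0 (z i)) {..<m} \<le> a
      \<and> L2_set (\<lambda>i. max 0 (- z i)) {..<m} \<le> b} \<in> sets (Leb m)"
    by measurable
  then show ?thesis by (simp add: sign_box_def space_Leb)
qed

text \<open>
  A Chernoff bound: the indicator of the box is dominated by a product of one-dimensional
  two-sided Gaussians. The rates \<open>h1\<close>, \<open>h2\<close> minimise the resulting integral.
\<close>

lemma emeasure_sign_box_le:
  assumes s: "0 < s" and t: "0 < t" and m: "0 < m"
  shows "emeasure (Leb m) (sign_box m (s ^ 3) (t ^ 3))
    \<le> ennreal ((sqrt (pi * exp 1 / (2 * real m)) * ((s\<^sup>2 + t\<^sup>2) * sqrt (s\<^sup>2 + t\<^sup>2))) ^ m)"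
proof -
  define S where "S = s\<^sup>2 + t\<^sup>2"
  have S: "S > 0" using s by (simp add: S_def add_pos_nonneg)
  define h1 where "h1 = real m / (2 * S * s ^ 4)"
  define h2 where "h2 = real m / (2 * S * t ^ 4)"
  have h: "h1 > 0" "h2 > 0" using s t S m by (simp_all add: h1_def h2_def)
  \<comment> \<open>With these rates \<open>h1 * (s ^ 3)\<^sup>2 + h2 * (t ^ 3)\<^sup>2\<close>
    equals \<open>m / 2\<close>, so the Chernoff factor \<open>exp (m / 2)\<close> splits into one
    \<open>exp (1/2)\<close> per coordinate.\<close>
  define F where "F x = ennreal (exp (1/2)) * (ennreal (indicator {0..} x * exp (- h1 * x\<^sup>2))
      + ennreal (indicator {0..} (- x) * exp (- h2 * x\<^sup>2)))" for x :: real
  have F_meas[measurable]: "F \<in> borel_measurable borel" unfolding F_def by measurable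
  \<comment> \<open>The two half-line integrals are the same multiple of \<open>s\<^sup>2\<close>
    and \<open>t\<^sup>2\<close>, so they add up to a multiple of \<open>S\<close>.\<close>
  have sq: "sqrt (pi / (real m / (2 * S * r ^ 4))) = sqrt (2 * pi * S / real m) * r\<^sup>2" if "r > 0" for r
  proof -
    have "pi / (real m / (2 * S * r ^ 4)) = (2 * pi * S / real m) * (r\<^sup>2)\<^sup>2"
      using that m S by (simp add: field_simps)
    then show ?thesis by (simp only: real_sqrt_mult real_sqrt_abs abs_power2)
  qed
  have e: "exp (1/2) = sqrt (exp 1 :: real)"
    by (rule real_sqrt_unique[symmetric]) (simp_all add: exp_double[symmetric])
  have "exp (1/2) * sqrt (2 * pi * S / real m) = sqrt (exp 1 * (2 * pi * S / real m))"
    by (simp only: e real_sqrt_mult)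
  also have "exp 1 * (2 * pi * S / real m) = (pi * exp 1 / (2 * real m)) * S * 2\<^sup>2"
    using m by (simp add: field_simps)
  also have "sqrt \<dots> = sqrt (pi * exp 1 / (2 * real m)) * sqrt S * 2"
    by (simp only: real_sqrt_mult real_sqrt_abs abs_numeral)
  finally have c: "exp (1/2) * sqrt (2 * pi * S / real m) = sqrt (pi * exp 1 / (2 * real m)) * sqrt S * 2" .
  have "(\<integral>\<^sup>+x. F x \<partial>lborel) = ennreal (exp (1/2)) * (ennreal (sqrt (pi / h1) / 2) + ennreal (sqrt (pi / h2) / 2))"
  proof -
    have "(\<integral>\<^sup>+x. F x \<partial>lborel) = ennreal (exp (1/2)) * (\<integral>\<^sup>+x. ennreal (indicator {0..} x * exp (- h1 * x\<^sup>2))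
        + ennreal (indicator {0..} (- x) * exp (- h2 * x\<^sup>2)) \<partial>lborel)"
      unfolding F_def by (rule nn_integral_cmult) measurable
    also have "(\<integral>\<^sup>+x. ennreal (indicator {0..} x * exp (- h1 * x\<^sup>2))
        + ennreal (indicator {0..} (- x) * exp (- h2 * x\<^sup>2)) \<partial>lborel)
      = (\<integral>\<^sup>+x. ennreal (indicator {0..} x * exp (- h1 * x\<^sup>2)) \<partial>lborel)
        + (\<integral>\<^sup>+x. ennreal (indicator {0..} (- x) * exp (- h2 * x\<^sup>2)) \<partial>lborel)"
      by (rule nn_integral_add) measurable
    finally show ?thesis
      by (simp only: nn_integral_gaussian_half_line[OF h(1)] nn_integral_gaussian_half_line[OF h(2)])
  qed
  also have "\<dots> = ennreal (exp (1/2) * (sqrt (pi / h1) / 2 + sqrt (pi / h2) / 2))"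
    using h by (subst ennreal_plus[symmetric]) (auto simp: ennreal_mult)
  also have "exp (1/2) * (sqrt (pi / h1) / 2 + sqrt (pi / h2) / 2)
      = exp (1/2) * sqrt (2 * pi * S / real m) * S / 2"
    unfolding h1_def h2_def by (simp only: sq[OF s] sq[OF t]) (simp add: S_def field_simps)
  also have "\<dots> = sqrt (pi * exp 1 / (2 * real m)) * (S * sqrt S)" by (simp add: c)
  finally have intF: "(\<integral>\<^sup>+x. F x \<partial>lborel) = ennreal (sqrt (pi * exp 1 / (2 * real m)) * (S * sqrt S))" .
  \<comment> \<open>Only an inequality, because at \<open>x = 0\<close> both half-line terms of
    \<open>F\<close> count.\<close>
  have F_ge: "ennreal (exp (1/2 - h1 * (max 0 x)\<^sup>2 - h2 * (max 0 (- x))\<^sup>2)) \<le> F x" for x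
  proof (cases "x \<ge> 0")
    case True
    have "ennreal (exp (1/2 - h1 * x\<^sup>2)) = ennreal (exp (1/2)) * ennreal (exp (- h1 * x\<^sup>2))"
      by (simp add: ennreal_mult[symmetric] exp_add[symmetric])
    also have "\<dots> \<le> F x"
      unfolding F_def using True by (intro mult_left_mono) (simp_all add: add_increasing2)
    finally show ?thesis using True by (cases "x = 0") (simp_all add: max_def)
  next
    case False
    have "ennreal (exp (1/2 - h2 * x\<^sup>2)) = ennreal (exp (1/2)) * ennreal (exp (- h2 * x\<^sup>2))"
      by (simp add: ennreal_mult[symmetric] exp_add[symmetric])
    also have "\<dots> \<le> F x"
      unfolding F_def using False by (intro mult_left_mono) (simp_all add: add_increasing)
    finally show ?thesis using False by (simp add: max_def)
  qed
  have dom: "indicator (sign_box m (s ^ 3) (t ^ 3)) z \<le> (\<Prod>i<m. F (z i))" for z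
  proof (cases "z \<in> sign_box m (s ^ 3) (t ^ 3)")
    case True
    define p where "p = (\<Sum>i<m. (max 0 (z i))\<^sup>2)"
    define q where "q = (\<Sum>i<m. (max 0 (- z i))\<^sup>2)"
    have "sqrt p \<le> s ^ 3" "sqrt q \<le> t ^ 3"
      using True by (auto simp: sign_box_def L2_set_def p_def q_def)
    then have pq: "p \<le> (s ^ 3)\<^sup>2" "q \<le> (t ^ 3)\<^sup>2" by (blast dest: sqrt_le_D)+
    have "h1 * p + h2 * q \<le> h1 * (s ^ 3)\<^sup>2 + h2 * (t ^ 3)\<^sup>2"
      using pq h by (intro add_mono mult_left_mono) auto
    also have "h1 * (s ^ 3)\<^sup>2 = real m / (2 * S) * s\<^sup>2"
      using s S by (simp add: h1_def field_simps eval_nat_numeral)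
    also have "h2 * (t ^ 3)\<^sup>2 = real m / (2 * S) * t\<^sup>2"
      using t S by (simp add: h2_def field_simps eval_nat_numeral)
    also have "real m / (2 * S) * s\<^sup>2 + real m / (2 * S) * t\<^sup>2 = real m / 2"
      using S unfolding distrib_left[symmetric] S_def[symmetric] by simp
    finally have le: "h1 * p + h2 * q \<le> real m / 2" .
    have "(\<Sum>i<m. 1/2 - h1 * (max 0 (z i))\<^sup>2 - h2 * (max 0 (- z i))\<^sup>2) = real m / 2 - h1 * p - h2 * q"
      by (simp add: sum_subtractf sum_distrib_left p_def q_def)
    then have "1 \<le> exp (\<Sum>i<m. 1/2 - h1 * (max 0 (z i))\<^sup>2 - h2 * (max 0 (- z i))\<^sup>2)"
      using le by simp
    then have "1 \<le> ennreal (exp (\<Sum>i<m. 1/2 - h1 * (max 0 (z i))\<^sup>2 - h2 * (max 0 (- z i))\<^sup>2))"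
      by (simp only: ennreal_1[symmetric]) (rule ennreal_leI)
    also have "\<dots> = (\<Prod>i<m. ennreal (exp (1/2 - h1 * (max 0 (z i))\<^sup>2 - h2 * (max 0 (- z i))\<^sup>2)))"
      by (simp add: exp_sum prod_ennreal)
    also have "\<dots> \<le> (\<Prod>i<m. F (z i))" by (intro prod_mono_ennreal F_ge)
    finally show ?thesis using True by simp
  qed simp
  interpret product_sigma_finite "\<lambda>_::nat. lborel :: real measure" by standard
  have "emeasure (Leb m) (sign_box m (s ^ 3) (t ^ 3)) = (\<integral>\<^sup>+z. indicator (sign_box m (s ^ 3) (t ^ 3)) z \<partial>Leb m)"
    using sets_sign_box by simp
  also have "\<dots> \<le> (\<integral>\<^sup>+z. (\<Prod>i<m. F (z i)) \<partial>Leb m)"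
    using dom by (intro nn_integral_mono)
  also have "\<dots> = (\<Prod>i<m. \<integral>\<^sup>+x. F x \<partial>lborel)"
    by (rule product_nn_integral_prod) (simp, simp add: F_meas)
  also have "\<dots> = ennreal ((sqrt (pi * exp 1 / (2 * real m)) * (S * sqrt S)) ^ m)"
    using S by (simp add: intF ennreal_power)
  finally show ?thesis by (simp add: S_def)
qed

section \<open>Covering a neighbourhood of the body by finitely many boxes\<close>

text \<open>Being nonnegative, \<open>v\<close> and \<open>w\<close> dominate the positive and
  negative parts of \<open>E_diff m v w\<close>. Those of \<open>y\<close> are therefore dominated
  by \<open>v\<close> and \<open>w\<close> plus the absolute error, and the triangle inequality for
  \<open>L2_set\<close> finishes.\<close>

lemma mem_sign_box_of_near_diff:
  assumes v: "v \<in> E_nonneg m" and w: "w \<in> E_nonneg m" and y: "y \<in> E_space m"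
    and near: "E_norm m (E_diff m y (E_diff m v w)) \<le> \<epsilon>"
  shows "y \<in> sign_box m (E_norm m v + \<epsilon>) (E_norm m w + \<epsilon>)"
proof -
  define d where "d i = \<bar>E_diff m y (E_diff m v w) i\<bar>" for i
  have d: "L2_set d {..<m} \<le> \<epsilon>" using near by (simp add: E_norm_def L2_set_def d_def)
  have le: "L2_set (\<lambda>i. max 0 (f i)) {..<m} \<le> E_norm m u + \<epsilon>"
    if "\<And>i. i < m \<Longrightarrow> max 0 (f i) \<le> u i + d i" for f u
  proof -
    have "L2_set (\<lambda>i. max 0 (f i)) {..<m} \<le> L2_set (\<lambda>i. u i + d i) {..<m}"
      using that by (intro L2_set_mono) auto
    also have "\<dots> \<le> L2_set u {..<m} + L2_set d {..<m}" by (rule L2_set_triangle_ineq)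
    finally show ?thesis using d by (simp add: E_norm_def)
  qed
  have "max 0 (y i) \<le> v i + d i" "max 0 (- y i) \<le> w i + d i" if "i < m" for i
    using that v w by (auto simp: d_def E_diff_def E_nonneg_def)
  then show ?thesis using y by (auto simp: sign_box_def intro!: le)
qed

lemma sign_box_mono: "a \<le> a' \<Longrightarrow> b \<le> b' \<Longrightarrow> sign_box m a b \<subseteq> sign_box m a' b'"
  by (auto simp: sign_box_def)

text \<open>Rounding up and going one step further: the margin \<open>\<delta>\<close> below absorbs
  the neighbourhood and forces a positive index.\<close>

lemma grid_point_above:
  fixes s \<delta> :: real
  assumes "0 < \<delta>" "0 \<le> s"
  obtains i :: nat where "s + \<delta> \<le> real i * \<delta>" "real i * \<delta> \<le> s + 2 * \<delta>"
proof
  let ?i = "nat \<lceil>s / \<delta>\<rceil> + 1"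
  have "0 \<le> s / \<delta>" using assms by simp
  then have "real ?i = of_int \<lceil>s / \<delta>\<rceil> + 1" by (simp add: ceiling_mono)
  then have "s / \<delta> + 1 \<le> real ?i" "real ?i \<le> s / \<delta> + 2"
    using ceiling_correct[of "s / \<delta>"] by linarith+
  then have "(s / \<delta> + 1) * \<delta> \<le> real ?i * \<delta>" "real ?i * \<delta> \<le> (s / \<delta> + 2) * \<delta>"
    using assms by (auto intro: mult_right_mono)
  then show "s + \<delta> \<le> real ?i * \<delta>" "real ?i * \<delta> \<le> s + 2 * \<delta>"
    using assms by (simp_all add: distrib_right)
qed

text \<open>The constants precede \<open>m\<close> because membership in a box depends on two norms
  only: one finite grid serves all dimensions, and \<open>N\<close> is its number of points.\<close>

lemma M_body_neighbourhood:
  obtains \<epsilon> N :: real where "\<epsilon> > 0"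
    "\<And>m. 0 < m \<Longrightarrow> \<exists>W\<in>sets (Leb m).
        (\<forall>z\<in>M_body m. \<forall>y\<in>E_space m. E_norm m (E_diff m y z) \<le> \<epsilon> \<longrightarrow> y \<in> W)
        \<and> emeasure (Leb m) W \<le> ennreal (N * (sqrt (pi * exp 1 / (2 * real m)) * (1.4698 * sqrt 1.4698)) ^ m)"
proof -
  \<comment> \<open>a grid in the cube roots of the side lengths, fine enough to fit between \<open>1.4696\<close> and \<open>1.4698\<close>\<close>
  define \<delta> :: real where "\<delta> = 1 / 50000"
  \<comment> \<open>The largest index corresponds to length \<open>100000 * \<delta> = 2\<close>,
    enough for every pair needed; indices start at 1 because \<open>emeasure_sign_box_le\<close>
    requires positive side lengths.\<close>
  define G where "G = {(i, j) \<in> {1..100000} \<times> {1..100000::nat}. (real i * \<delta>)\<^sup>2 + (real j * \<delta>)\<^sup>2 \<le> 1.4698}"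
  have fin: "finite G" unfolding G_def by (rule finite_subset[of _ "{1..100000} \<times> {1..100000}"]) auto
  have \<delta>: "\<delta> > 0" by (simp add: \<delta>_def)
  define W where "W m = (\<Union>(i, j)\<in>G. sign_box m ((real i * \<delta>) ^ 3) ((real j * \<delta>) ^ 3))" for m
  have nbhd: "y \<in> W m" if z: "z \<in> M_body m" and y: "y \<in> E_space m" "E_norm m (E_diff m y z) \<le> \<delta> ^ 3" for m y z
  proof -
    obtain v w where z: "z = E_diff m v w" "v \<in> E_nonneg m" "w \<in> E_nonneg m"
      and le: "(E_norm m v)\<^sup>2 + (E_norm m w + sqrt 2)\<^sup>2 \<le> 4"
      using z by (auto simp: M_body_def)
    define s where "s = root 3 (E_norm m v)"
    define t where "t = root 3 (E_norm m w)"
    have nn: "0 \<le> E_norm m v" "0 \<le> E_norm m w" by (auto simp: E_norm_def)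
    have st: "0 \<le> s" "0 \<le> t" "s ^ 3 = E_norm m v" "t ^ 3 = E_norm m w"
      using nn by (simp_all add: s_def t_def)
    have sum: "s\<^sup>2 + t\<^sup>2 \<le> 1.4696" by (rule cube_root_profile_bound) (use st le in simp_all)
    have "s + t \<le> 2"
    proof -
      have "(s + t)\<^sup>2 \<le> 2 * (s\<^sup>2 + t\<^sup>2)" using zero_le_power2[of "s - t"] by (simp add: power2_eq_square algebra_simps)
      then have "(s + t)\<^sup>2 \<le> 2\<^sup>2" using sum by simp
      then show ?thesis by (rule power2_le_imp_le) simp
    qed
    obtain i where i: "s + \<delta> \<le> real i * \<delta>" "real i * \<delta> \<le> s + 2 * \<delta>" using grid_point_above[OF \<delta> st(1)] .
    obtain j where j: "t + \<delta> \<le> real j * \<delta>" "real j * \<delta> \<le> t + 2 * \<delta>" using grid_point_above[OF \<delta> st(2)] .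
    have "(real i * \<delta>)\<^sup>2 + (real j * \<delta>)\<^sup>2 \<le> (s + 2 * \<delta>)\<^sup>2 + (t + 2 * \<delta>)\<^sup>2"
      using i j \<delta> by (intro add_mono power_mono) auto
    also have "\<dots> = s\<^sup>2 + t\<^sup>2 + 4 * \<delta> * (s + t) + 8 * \<delta>\<^sup>2" by (simp add: power2_eq_square algebra_simps)
    also have "\<dots> \<le> 1.4696 + 4 * \<delta> * 2 + 8 * \<delta>\<^sup>2"
      using sum \<open>s + t \<le> 2\<close> \<delta> by (intro add_mono mult_left_mono) auto
    \<comment> \<open>The gap is \<open>0.0002\<close>, while \<open>8 * \<delta>\<close> is
      \<open>0.00016\<close> and the quadratic term is negligible.\<close>
    also have "\<dots> \<le> 1.4698" by (simp add: \<delta>_def power2_eq_square)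
    finally have ij: "(real i * \<delta>)\<^sup>2 + (real j * \<delta>)\<^sup>2 \<le> 1.4698" .
    have pos: "1 \<le> i" "1 \<le> j" using i(1) j(1) st(1,2) \<delta> by (cases i; cases j; simp)+
    have "i \<le> 100000" "j \<le> 100000"
    proof -
      have "k \<le> 100000" if "(real k * \<delta>)\<^sup>2 \<le> 1.4698" for k
      proof -
        have "(real k * \<delta>)\<^sup>2 \<le> 2\<^sup>2" using that by simp
        then have "real k * \<delta> \<le> 2" by (rule power2_le_imp_le) simp
        then show ?thesis by (simp add: \<delta>_def)
      qed
      moreover have "(real i * \<delta>)\<^sup>2 \<le> 1.4698" "(real j * \<delta>)\<^sup>2 \<le> 1.4698"
        using ij zero_le_power2[of "real i * \<delta>"] zero_le_power2[of "real j * \<delta>"] by linarith+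
      ultimately show "i \<le> 100000" "j \<le> 100000" by auto
    qed
    then have G: "(i, j) \<in> G" using pos ij by (simp add: G_def)
    \<comment> \<open>The origin of the radius \<open>\<delta> ^ 3\<close>: enlarging a norm
      \<open>r ^ 3\<close> by it raises the cube root by at most \<open>\<delta>\<close>.\<close>
    have cube: "r ^ 3 + \<delta> ^ 3 \<le> (real k * \<delta>) ^ 3" if "0 \<le> r" "r + \<delta> \<le> real k * \<delta>" for r k
    proof -
      have "r ^ 3 + \<delta> ^ 3 \<le> (r + \<delta>) ^ 3" using that(1) \<delta> by (simp add: power3_eq_cube algebra_simps)
      also have "\<dots> \<le> (real k * \<delta>) ^ 3" using that \<delta> by (intro power_mono) auto
      finally show ?thesis .
    qed
    have "y \<in> sign_box m (s ^ 3 + \<delta> ^ 3) (t ^ 3 + \<delta> ^ 3)"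
      using mem_sign_box_of_near_diff[OF z(2,3) y(1)] y(2) z(1) st by simp
    then have "y \<in> sign_box m ((real i * \<delta>) ^ 3) ((real j * \<delta>) ^ 3)"
      using sign_box_mono[OF cube[OF st(1) i(1)] cube[OF st(2) j(1)]] by blast
    then show ?thesis using G by (auto simp: W_def)
  qed
  have meas: "W m \<in> sets (Leb m)" for m
    unfolding W_def using fin by (intro sets.finite_UN) (auto intro: sets_sign_box)
  have vol: "emeasure (Leb m) (W m) \<le> ennreal (real (card G) * (sqrt (pi * exp 1 / (2 * real m)) * (1.4698 * sqrt 1.4698)) ^ m)"
    (is "_ \<le> ennreal (real (card G) * ?b)") if m: "0 < m" for m
  proof -
    have "emeasure (Leb m) (W m) \<le> (\<Sum>p\<in>G. emeasure (Leb m) (case p of (i, j) \<Rightarrow> sign_box m ((real i * \<delta>) ^ 3) ((real j * \<delta>) ^ 3)))"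
      unfolding W_def using fin by (intro emeasure_subadditive_finite) (auto simp: sets_sign_box)
    also have "\<dots> \<le> (\<Sum>p\<in>G. ennreal ?b)"
    proof (rule sum_mono)
      fix p assume p: "p \<in> G"
      obtain i j where ij: "p = (i, j)" by (cases p)
      define r where "r = (real i * \<delta>)\<^sup>2 + (real j * \<delta>)\<^sup>2"
      have r: "0 \<le> r" "r \<le> 1.4698" and pos: "0 < real i * \<delta>" "0 < real j * \<delta>"
        using p ij \<delta> by (auto simp: G_def r_def)
      have "(sqrt (pi * exp 1 / (2 * real m)) * (r * sqrt r)) ^ m \<le> ?b"
        using r by (intro power_mono mult_left_mono mult_mono real_sqrt_le_mono) auto
      then show "emeasure (Leb m) (case p of (i, j) \<Rightarrow> sign_box m ((real i * \<delta>) ^ 3) ((real j * \<delta>) ^ 3)) \<le> ennreal ?b"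
        using emeasure_sign_box_le[OF pos m] unfolding ij r_def[symmetric] prod.case
        by (meson ennreal_leI order_trans)
    qed
    also have "\<dots> = ennreal (real (card G) * ?b)"
      by (simp add: ennreal_mult ennreal_of_nat_eq_real_of_nat)
    finally show ?thesis .
  qed
  show ?thesis
    by (rule that[of "\<delta> ^ 3" "real (card G)"]) (use \<delta> nbhd meas vol in \<open>auto intro!: bexI[of _ "W _"]\<close>)
qed

section \<open>Comparison with Euclidean balls\<close>

text \<open>The upper bound on \<open>Gamma\<close> bounds the ball volume from below. It turns the
  Chernoff bound into the volume of a ball at the cost of a factor linear in
  \<open>m\<close>.\<close>

lemma unit_ball_vol_lower:
  obtains C where "C > 0" "\<And>m. 0 < m \<Longrightarrow> sqrt (2 * pi * exp 1 / real m) ^ m \<le> C * real m * unit_ball_vol (real m)"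
proof -
  obtain C where C: "C > 0" and le: "\<And>m. m \<ge> 1 \<Longrightarrow>
      Gamma (real m / 2 + 1) \<le> C * (real m / 2) * (real m / 2 / exp 1) powr (real m / 2)"
    using Gamma_le_powr by auto
  have "sqrt (2 * pi * exp 1 / real m) ^ m \<le> C * real m * unit_ball_vol (real m)" if m: "0 < m" for m
  proof -
    let ?q = "(real m / 2 / exp 1) powr (real m / 2)"
    have q: "?q > 0" using m by simp
    have G: "Gamma (real m / 2 + 1) > 0" by (intro Gamma_real_pos) auto
    have "sqrt (2 * pi * exp 1 / real m) ^ m = (2 * pi * exp 1 / real m) powr (real m / 2)"
      using m by (simp add: powr_half_sqrt[symmetric] powr_powr powr_realpow[symmetric])
    also have "\<dots> = (pi / (real m / 2 / exp 1)) powr (real m / 2)" by (simp add: mult_ac)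
    also have "\<dots> = pi powr (real m / 2) / ?q"
      using m by (subst powr_divide) auto
    also have "\<dots> \<le> pi powr (real m / 2) * (C * (real m / 2) / Gamma (real m / 2 + 1))"
    proof -
      have "1 / ?q \<le> C * (real m / 2) / Gamma (real m / 2 + 1)"
        using le[of m] m q G by (simp add: field_simps)
      from mult_left_mono[OF this, of "pi powr (real m / 2)"] show ?thesis by simp
    qed
    also have "\<dots> = (C / 2) * real m * unit_ball_vol (real m)" by (simp add: unit_ball_vol_def)
    also have "\<dots> \<le> C * real m * unit_ball_vol (real m)"
      using C by (intro mult_right_mono) auto
    finally show ?thesis .
  qed
  then show ?thesis using C that by blast
qed

theorem theorem1p4:
  shows "\<exists>n0::nat. 0 < n0 \<and>
    (\<forall>n\<ge>n0. \<forall>\<phi>. hyperplane_ident n \<phi> \<longrightarrow>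
       Vol n (pullback n \<phi> (U_body n)) < Vol n (E_ball n 0.891))"
proof -
  obtain \<epsilon> N where \<epsilon>: "\<epsilon> > 0" and W: "\<And>m. 0 < m \<Longrightarrow> \<exists>W\<in>sets (Leb m).
      (\<forall>z\<in>M_body m. \<forall>y\<in>E_space m. E_norm m (E_diff m y z) \<le> \<epsilon> \<longrightarrow> y \<in> W)
      \<and> emeasure (Leb m) W \<le> ennreal (N * (sqrt (pi * exp 1 / (2 * real m)) * (1.4698 * sqrt 1.4698)) ^ m)"
    using M_body_neighbourhood by metis
  obtain C where C: "C > 0" and ball: "\<And>m. 0 < m \<Longrightarrow>
      sqrt (2 * pi * exp 1 / real m) ^ m \<le> C * real m * unit_ball_vol (real m)"
    using unit_ball_vol_lower by blast
  \<comment> \<open>The radius of the ball to which the Chernoff bound with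
    \<open>S = 1.4698\<close> corresponds.\<close>
  define \<rho> :: real where "\<rho> = 1.4698 * sqrt 1.4698 / 2"
  define q where "q = \<rho> / 0.891"
  \<comment> \<open>Here \<open>1.782\<close> is twice \<open>0.891\<close>; squared, the claim is
    about \<open>3.1752 < 3.1755\<close>.\<close>
  have "sqrt (1.4698 ^ 3) < (1.782 :: real)"
    by (rule real_less_lsqrt) (simp_all add: power2_eq_square eval_nat_numeral)
  moreover have "sqrt (x ^ 3) = x * sqrt x" if "0 \<le> x" for x :: real
    using that by (simp add: power3_eq_cube real_sqrt_mult)
  from this[of "1.4698"] have "sqrt (1.4698 ^ 3) = 1.4698 * sqrt (1.4698::real)" by (simp del: power_divide)
  ultimately have \<rho>: "0 < \<rho>" "\<rho> < 0.891" by (simp_all add: \<rho>_def)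
  then have q: "0 < q" "q < 1" by (simp_all add: q_def)
  \<comment> \<open>Since \<open>\<rho> < 0.891\<close>, the decay of \<open>q ^ m\<close> absorbs
    the linear factor and all constants. The factor \<open>0.891 / \<epsilon>\<close> pays for
    passing from dimension \<open>m = n + 1\<close> to \<open>n\<close>; the sign of
    \<open>N\<close> is not recorded, hence the absolute value.\<close>
  have "(\<lambda>m. \<bar>N\<bar> * C * 0.891 / \<epsilon> * (real m * q ^ m)) \<longlonglongrightarrow> \<bar>N\<bar> * C * 0.891 / \<epsilon> * 0"
    using q by (intro tendsto_mult_left powser_times_n_limit_0) auto
  then have "\<forall>\<^sub>F m in sequentially. \<bar>N\<bar> * C * 0.891 / \<epsilon> * (real m * q ^ m) < 1"
    by (intro order_tendstoD(2)) auto
  then obtain m0 where m0: "\<And>m. m \<ge> m0 \<Longrightarrow> \<bar>N\<bar> * C * 0.891 / \<epsilon> * (real m * q ^ m) < 1"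
    by (auto simp: eventually_sequentially)
  have "Vol n (pullback n \<phi> (U_body n)) < Vol n (E_ball n 0.891)"
    if n: "n \<ge> Suc m0" and \<phi>: "hyperplane_ident n \<phi>" for n \<phi>
  proof -
    define m where "m = Suc n"
    have m: "0 < m" by (simp add: m_def)
    define u where "u = unit_ball_vol (real m)"
    define u' where "u' = unit_ball_vol (real n)"
    have u: "u > 0" "u' > 0" by (simp_all add: u_def u'_def)
    obtain W where W_sets: "W \<in> sets (Leb m)"
      and nbhd: "\<And>z y. z \<in> M_body m \<Longrightarrow> y \<in> E_space m \<Longrightarrow> E_norm m (E_diff m y z) \<le> \<epsilon> \<Longrightarrow> y \<in> W"
      and vol: "emeasure (Leb m) W \<le> ennreal (N * (sqrt (pi * exp 1 / (2 * real m)) * (1.4698 * sqrt 1.4698)) ^ m)"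
      using W[OF m] by blast
    have half: "sqrt (pi * exp 1 / (2 * real m)) = sqrt (2 * pi * exp 1 / real m) / 2"
    proof -
      have "pi * exp 1 / (2 * real m) = (2 * pi * exp 1 / real m) / 2\<^sup>2" by simp
      then show ?thesis by (simp only: real_sqrt_divide real_sqrt_abs abs_numeral)
    qed
    have "(sqrt (pi * exp 1 / (2 * real m)) * (1.4698 * sqrt 1.4698)) ^ m
        = sqrt (2 * pi * exp 1 / real m) ^ m * \<rho> ^ m"
      unfolding power_mult_distrib[symmetric] half \<rho>_def by simp
    also have "\<dots> \<le> C * real m * u * \<rho> ^ m"
      using ball[OF m] \<rho> by (intro mult_right_mono) (auto simp: u_def)
    finally have "N * (sqrt (pi * exp 1 / (2 * real m)) * (1.4698 * sqrt 1.4698)) ^ m \<le> \<bar>N\<bar> * (C * real m * u * \<rho> ^ m)"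
      by (intro mult_mono) auto
    also have "\<dots> < \<epsilon> * 0.891 ^ n * u"
    proof -
      have "\<bar>N\<bar> * C * 0.891 / \<epsilon> * (real m * q ^ m) < 1" using m0[of m] n by (simp add: m_def)
      then have "\<bar>N\<bar> * C * 0.891 * (real m * q ^ m) < \<epsilon>" using \<epsilon> by (simp add: field_simps)
      then have "\<bar>N\<bar> * C * 0.891 * (real m * q ^ m) * (0.891 ^ n * u) < \<epsilon> * (0.891 ^ n * u)"
        using u by (intro mult_strict_right_mono) auto
      moreover have \<rho>m: "\<rho> ^ m = q ^ m * (0.891 * 0.891 ^ n)"
        unfolding power_Suc[symmetric] m_def power_mult_distrib[symmetric] by (simp add: q_def)
      ultimately show ?thesis unfolding \<rho>m by (simp only: mult_ac)
    qed
    finally have N_less: "N * (sqrt (pi * exp 1 / (2 * real m)) * (1.4698 * sqrt 1.4698)) ^ m < \<epsilon> * 0.891 ^ n * u" .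
    let ?X = "pullback n \<phi> (U_body n)"
    \<comment> \<open>The ratio of \<open>u'\<close> to \<open>u\<close> never has to be estimated:
      \<open>N_less\<close> supplies a factor \<open>u\<close> that cancels, and \<open>u'\<close>
      is the factor in the volume of the target ball.\<close>
    have "ennreal (u * \<epsilon> ^ m) * emeasure (Leb n) ?X \<le> ennreal (u' * \<epsilon> ^ n) * emeasure (Leb m) W"
      using emeasure_pullback_projection_le[OF \<phi> \<epsilon>, of "M_body (Suc n)" W]
        sets_pullback_U_body[OF \<phi>] W_sets nbhd
      by (simp add: U_body_def m_def emeasure_Leb_ball(1)[OF \<epsilon>] u_def u'_def)
    also have "\<dots> < ennreal (u' * \<epsilon> ^ n) * ennreal (\<epsilon> * 0.891 ^ n * u)"
    proof (rule ennreal_mult_strict_left_mono)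
      show "emeasure (Leb m) W < ennreal (\<epsilon> * 0.891 ^ n * u)"
        by (rule le_less_trans[OF vol], rule ennreal_lessI[OF _ N_less]) (use u \<epsilon> in simp)
    qed (use u \<epsilon> in simp_all)
    also have "\<dots> = ennreal (u * \<epsilon> ^ m) * ennreal (u' * 0.891 ^ n)"
      using u \<epsilon> by (simp add: ennreal_mult[symmetric] m_def mult_ac)
    finally have "emeasure (Leb n) ?X < ennreal (u' * 0.891 ^ n)"
      by (metis mult_left_mono not_le zero_le)
    then show ?thesis
      by (simp add: Vol_def emeasure_Leb_ball(1) u'_def)
  qed
  then show ?thesis by (intro exI[of _ "Suc m0"]) auto
qed

end
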